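(* Let $\theta=(u,v,w)^T$, and let $X_n[\theta]=\delta H_n/\delta\theta$, $n\ge1$, be the variational derivatives of the Hamiltonian functionals $H_n$ of the positive 3-Novikov hierarchy, defined by $H_1=\int pw\,dx$ (so $X_1[\theta]=(0,r,p)^T$) and the recursion $X_{n+1}[\theta]=\mathcal J^{-1}\mathcal K X_n[\theta]$, $n\ge1$. Then the $X_n$ are homogeneous in the sense that $$X_n[\epsilon\theta]=\epsilon^{2n-1}X_n[\theta],\qquad n\ge1,$$ and $$H_n[\theta]=\frac1{2n}\int X_n[\theta]\cdot\theta\,dx,\qquad n\ge1 .$$
   Context: $u,v,w$ are smooth rapidly decaying functions of $x$, $p=(1-\partial^2)^{-1}v$, $r=(1-\partial^2)^{-1}w$, $\partial=\partial_x$, and $$\mathcal J=\begin{pmatrix}\tfrac12\partial&0&0\\0&0&1-\partial^2\\0&\partial^2-1&0\end{pmatrix},\quad \mathcal K=\begin{pmatrix}0&0&0\\0&\tfrac32v\partial^{-1}v&-u^2-\tfrac32v\partial^{-1}w\\0&u^2-\tfrac32w\partial^{-1}v&\tfrac32w\partial^{-1}w\end{pmatrix}-2\,\Omega(\partial^3-4\partial)^{-1}\Omega^{*},$$ with $\Omega=(\partial u,\ \tfrac12v\partial+\partial v,\ \tfrac12w\partial+\partial w)^T$ and $\Omega^{*}$ its formal adjoint, $\Omega^*=(-u\partial,\,-\tfrac12\partial v-v\partial,\,-\tfrac12\partial w-w\partial)$. Products like $\partial u$ are operator compositions. $\partial^{-1}$, $(\partial^3-4\partial)^{-1}$ and $\mathcal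 J^{-1}$ are formal inverses with zero integration constants. The operators $\mathcal J,\mathcal K$ form a compatible pair of Hamiltonian operators (known), and $H_n$ denotes the functional with variational derivative $\delta H_n/\delta\theta=X_n$, normalized by $H_n[0]=0$. $\epsilon$ is a real scalar. *)

theory Defs
  imports "HOL-Analysis.Analysis"
begin

definition smooth_fun :: "(real \<Rightarrow> real) \<Rightarrow> bool" where
  "smooth_fun f \<longleftrightarrow> (\<forall>k. (deriv ^^ k) f differentiable_on UNIV)"

definition schwartz :: "(real \<Rightarrow> real) set" where
  "schwartz = {f. smooth_fun f \<and> (\<forall>m k. bounded (range (\<lambda>x. x ^ m * (deriv ^^ k) f x)))}"

text \<open>
  Vector fields \<open>\<theta> = (u, v, w)\<close> are functions of type \<open>real \<Rightarrow> real^3\<close>, with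
  \<open>u = (\<lambda>x. \<theta> x $ 1)\<close> and so on.
\<close>

definition schwartz3 :: "(real \<Rightarrow> real^3) set" where
  "schwartz3 = {\<theta>. \<forall>i. (\<lambda>x. \<theta> x $ i) \<in> schwartz}"

text \<open>
  Formal inverses with zero integration constants.  An inverse is taken among the smooth
  bounded functions that vanish at \<open>-\<infinity>\<close>.  On this space each of \<open>\<partial>\<close>, \<open>1 - \<partial>\<^sup>2\<close> and
  \<open>\<partial>\<^sup>3 - 4\<partial>\<close> is injective, and its image contains all Schwartz functions, so that for
  instance \<open>\<partial>\<^sup>-\<^sup>1 f\<close> is the integral of \<open>f\<close> from \<open>-\<infinity>\<close>.  If \<open>f\<close> has a Schwartz preimage,
  then this is the one that is chosen.  The Schwartz functions themselves would be too
  small: the entries of the operator \<open>op_K\<close> below apply \<open>\<partial>\<^sup>-\<^sup>1\<close> separately to two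
  functions of which only the difference has mean zero.  Outside the image the inverse is set to \<open>0\<close>.
\<close>

definition null_const :: "(real \<Rightarrow> real) set" where
  "null_const = {g. smooth_fun g \<and> bounded (range g) \<and> (g \<longlongrightarrow> 0) at_bot}"

definition null_const3 :: "(real \<Rightarrow> real^3) set" where
  "null_const3 = {Y. \<forall>i. (\<lambda>x. Y x $ i) \<in> null_const}"

definition formal_inv ::
    "(real \<Rightarrow> 'b::zero) set \<Rightarrow> ((real \<Rightarrow> 'b) \<Rightarrow> (real \<Rightarrow> 'b)) \<Rightarrow> (real \<Rightarrow> 'b) \<Rightarrow> (real \<Rightarrow> 'b)" where
  "formal_inv G L f = (if f \<in> L ` G then inv_into G L f else (\<lambda>_. 0))"

definition helmholtz :: "(real \<Rightarrow> real) \<Rightarrow> real \<Rightarrow> real" where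
  "helmholtz f = (\<lambda>x. f x - (deriv ^^ 2) f x)"

definition inv_deriv :: "(real \<Rightarrow> real) \<Rightarrow> real \<Rightarrow> real" where
  "inv_deriv = formal_inv null_const deriv"

definition inv_helmholtz :: "(real \<Rightarrow> real) \<Rightarrow> real \<Rightarrow> real" where
  "inv_helmholtz = formal_inv null_const helmholtz"

definition inv_cubic :: "(real \<Rightarrow> real) \<Rightarrow> real \<Rightarrow> real" where
  "inv_cubic = formal_inv null_const (\<lambda>g x. (deriv ^^ 3) g x - 4 * deriv g x)"

definition op_J :: "(real \<Rightarrow> real^3) \<Rightarrow> real \<Rightarrow> real^3" where
  "op_J Y = (let a = (\<lambda>x. Y x $ 1); b = (\<lambda>x. Y x $ 2); c = (\<lambda>x. Y x $ 3) in
     (\<lambda>x. vector [1/2 * deriv a x, helmholtz c x, (deriv ^^ 2) b x - b x]))"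

definition inv_J :: "(real \<Rightarrow> real^3) \<Rightarrow> real \<Rightarrow> real^3" where
  "inv_J = formal_inv null_const3 op_J"

definition op_Omega :: "(real \<Rightarrow> real^3) \<Rightarrow> (real \<Rightarrow> real) \<Rightarrow> real \<Rightarrow> real^3" where
  "op_Omega \<theta> f = (let u = (\<lambda>x. \<theta> x $ 1); v = (\<lambda>x. \<theta> x $ 2); w = (\<lambda>x. \<theta> x $ 3) in
     (\<lambda>x. vector
       [deriv (\<lambda>y. u y * f y) x,
        1/2 * v x * deriv f x + deriv (\<lambda>y. v y * f y) x,
        1/2 * w x * deriv f x + deriv (\<lambda>y. w y * f y) x]))"

definition op_Omega_adj :: "(real \<Rightarrow> real^3) \<Rightarrow> (real \<Rightarrow> real^3) \<Rightarrow> real \<Rightarrow> real" where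
  "op_Omega_adj \<theta> Y = (let u = (\<lambda>x. \<theta> x $ 1); v = (\<lambda>x. \<theta> x $ 2); w = (\<lambda>x. \<theta> x $ 3);
       a = (\<lambda>x. Y x $ 1); b = (\<lambda>x. Y x $ 2); c = (\<lambda>x. Y x $ 3) in
     (\<lambda>x. - u x * deriv a x
          + (- 1/2 * deriv (\<lambda>y. v y * b y) x - v x * deriv b x)
          + (- 1/2 * deriv (\<lambda>y. w y * c y) x - w x * deriv c x)))"

definition op_K :: "(real \<Rightarrow> real^3) \<Rightarrow> (real \<Rightarrow> real^3) \<Rightarrow> real \<Rightarrow> real^3" where
  "op_K \<theta> Y = (let u = (\<lambda>x. \<theta> x $ 1); v = (\<lambda>x. \<theta> x $ 2); w = (\<lambda>x. \<theta> x $ 3);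
       b = (\<lambda>x. Y x $ 2); c = (\<lambda>x. Y x $ 3) in
     (\<lambda>x. vector
       [0,
        3/2 * v x * inv_deriv (\<lambda>y. v y * b y) x
          + (- (u x)\<^sup>2 * c x - 3/2 * v x * inv_deriv (\<lambda>y. w y * c y) x),
        ((u x)\<^sup>2 * b x - 3/2 * w x * inv_deriv (\<lambda>y. v y * b y) x)
          + 3/2 * w x * inv_deriv (\<lambda>y. w y * c y) x]
       - 2 *\<^sub>R op_Omega \<theta> (inv_cubic (op_Omega_adj \<theta> Y)) x))"

definition p_of :: "(real \<Rightarrow> real^3) \<Rightarrow> real \<Rightarrow> real" where
  "p_of \<theta> = inv_helmholtz (\<lambda>x. \<theta> x $ 2)"

definition r_of :: "(real \<Rightarrow> real^3) \<Rightarrow> real \<Rightarrow> real" where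
  "r_of \<theta> = inv_helmholtz (\<lambda>x. \<theta> x $ 3)"

text \<open>The index starts at \<open>1\<close>; the value at \<open>n = 0\<close> has no meaning.\<close>

definition hierarchy :: "nat \<Rightarrow> (real \<Rightarrow> real^3) \<Rightarrow> real \<Rightarrow> real^3" where
  "hierarchy n \<theta> =
     ((\<lambda>Y. inv_J (op_K \<theta> Y)) ^^ (n - 1)) (\<lambda>x. vector [0, r_of \<theta> x, p_of \<theta> x])"

definition has_variational_derivative ::
    "((real \<Rightarrow> real^3) \<Rightarrow> real) \<Rightarrow> ((real \<Rightarrow> real^3) \<Rightarrow> real \<Rightarrow> real^3) \<Rightarrow> bool" where
  "has_variational_derivative F X \<longleftrightarrow>
     (\<forall>\<theta>\<in>schwartz3. \<forall>\<phi>\<in>schwartz3.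
        integrable lborel (\<lambda>x. X \<theta> x \<bullet> \<phi> x) \<and>
        ((\<lambda>t. F (\<lambda>x. \<theta> x + t *\<^sub>R \<phi> x)) has_real_derivative
           (LINT x|lborel. X \<theta> x \<bullet> \<phi> x)) (at 0))"

end

theory Submission
  imports Defs
begin

text \<open>
  Every formal inverse is taken on a space of functions on which the operator is linear and
  injective, so it commutes with scalar multiplication; \<open>op_K\<close> is quadratic in \<open>\<theta>\<close>, so each step
  of the recursion raises the degree of homogeneity by two.  Then \<open>H\<^sub>n[t\<theta>]\<close> has the derivative
  \<open>t\<^sup>2\<^sup>n\<^sup>-\<^sup>1 \<integral> X\<^sub>n[\<theta>] \<cdot> \<theta> dx\<close> in \<open>t\<close>, which is integrated from \<open>0\<close> to \<open>1\<close>.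

  Differentiability must be tracked throughout: \<open>deriv\<close> has an arbitrary value at points where
  the derivative does not exist, and is not homogeneous there.
\<close>

subsection \<open>Iterated derivatives of smooth functions\<close>

lemma smooth_fun_has_real_derivative:
  assumes "smooth_fun f"
  shows "((deriv ^^ k) f has_real_derivative (deriv ^^ Suc k) f x) (at x)"
  using assms
  by (auto simp: smooth_fun_def differentiable_on_def DERIV_deriv_iff_real_differentiable)

lemmas smooth_fun_DERIV = smooth_fun_has_real_derivative[where k = 0, simplified]

lemma iterated_deriv_linear:
  assumes "smooth_fun f" "smooth_fun g"
  shows "(deriv ^^ k) (\<lambda>x. a * f x + b * g x) = (\<lambda>x. a * (deriv ^^ k) f x + b * (deriv ^^ k) g x)"
proof (induction k)
  case (Suc k)
  have "((\<lambda>x. a * (deriv ^^ k) f x + b * (deriv ^^ k) g x) has_real_derivative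
          a * (deriv ^^ Suc k) f x + b * (deriv ^^ Suc k) g x) (at x)" for x
    by (intro DERIV_add DERIV_cmult smooth_fun_has_real_derivative assms)
  then show ?case
    by (auto simp: Suc intro!: DERIV_imp_deriv)
qed simp

lemma iterated_deriv_scale:
  assumes "smooth_fun f"
  shows "(deriv ^^ k) (\<lambda>x. c * f x) = (\<lambda>x. c * (deriv ^^ k) f x)"
  using iterated_deriv_linear[OF assms assms, of k c 0] by simp

lemma deriv_scale:
  fixes f :: "real \<Rightarrow> real"
  assumes "f differentiable at x"
  shows "deriv (\<lambda>y. c * f y) x = c * deriv f x"
  using assms by (intro DERIV_imp_deriv DERIV_cmult) (simp add: DERIV_deriv_iff_real_differentiable)

lemma smooth_fun_differentiable: "smooth_fun f \<Longrightarrow> f differentiable at x"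
  using smooth_fun_DERIV real_differentiable_def by blast

lemma smooth_fun_linear:
  assumes "smooth_fun f" "smooth_fun g"
  shows "smooth_fun (\<lambda>x. a * f x + b * g x)"
  using assms unfolding smooth_fun_def iterated_deriv_linear[OF assms] by simp

lemma iterated_deriv_zero: "(deriv ^^ k) (\<lambda>_. 0 :: real) = (\<lambda>_. 0)"
  by (induction k) auto

section \<open>Linear structure of the function spaces\<close>

lemma null_const_linear:
  assumes "f \<in> null_const" "g \<in> null_const"
  shows "(\<lambda>x. a * f x + b * g x) \<in> null_const"
proof -
  have "bounded (range (\<lambda>x. a * f x))" "bounded (range (\<lambda>x. b * g x))"
    using assms bounded_scaling[of "range f" a] bounded_scaling[of "range g" b]
    by (auto simp: null_const_def image_image)
  then have "bounded (range (\<lambda>x. a * f x + b * g x))"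
    by (rule bounded_plus_comp)
  moreover have "((\<lambda>x. a * f x + b * g x) \<longlongrightarrow> a * 0 + b * 0) at_bot"
    using assms by (intro tendsto_intros) (auto simp: null_const_def)
  ultimately show ?thesis
    using assms smooth_fun_linear by (auto simp: null_const_def)
qed

lemma null_const_scale: "f \<in> null_const \<Longrightarrow> (\<lambda>x. c * f x) \<in> null_const"
  using null_const_linear[of f f c 0] by simp

lemma null_const_zero: "(\<lambda>_. 0) \<in> null_const"
  by (auto simp: null_const_def smooth_fun_def iterated_deriv_zero)

lemma null_const3_scale: "Y \<in> null_const3 \<Longrightarrow> (\<lambda>x. c *\<^sub>R Y x) \<in> null_const3"
  by (simp add: null_const3_def null_const_scale)

lemma null_const3_zero: "(\<lambda>_. 0) \<in> null_const3"
  by (simp add: null_const3_def null_const_zero)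

lemma schwartz_scale:
  assumes "f \<in> schwartz"
  shows "(\<lambda>x. c * f x) \<in> schwartz"
proof -
  have f: "smooth_fun f" and bdd: "\<And>m k. bounded (range (\<lambda>x. x ^ m * (deriv ^^ k) f x))"
    using assms by (auto simp: schwartz_def)
  have "bounded (range (\<lambda>x. x ^ m * (c * (deriv ^^ k) f x)))" for m k
    using bounded_scaling[OF bdd[of m k], of c] by (simp add: image_image mult.left_commute)
  then show ?thesis
    using smooth_fun_linear[OF f f, of c 0] by (simp add: schwartz_def iterated_deriv_scale[OF f])
qed

lemma schwartz3_scale: "\<theta> \<in> schwartz3 \<Longrightarrow> (\<lambda>x. c *\<^sub>R \<theta> x) \<in> schwartz3"
  by (simp add: schwartz3_def schwartz_scale)


subsection \<open>Injectivity of the differential operators\<close>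

text \<open>A linear map with trivial kernel is injective. The difference is written with the
  factors \<open>1\<close> and \<open>-1\<close> so that it is an instance of
  \<open>null_const_linear\<close> and \<open>iterated_deriv_linear\<close>.\<close>

lemma inj_on_null_constI:
  fixes L :: "(real \<Rightarrow> real) \<Rightarrow> real \<Rightarrow> real"
  assumes linear: "\<And>f g. f \<in> null_const \<Longrightarrow> g \<in> null_const \<Longrightarrow>
      L (\<lambda>x. 1 * f x + (-1) * g x) = (\<lambda>x. 1 * L f x + (-1) * L g x)"
    and kernel: "\<And>f. f \<in> null_const \<Longrightarrow> L f = (\<lambda>_. 0) \<Longrightarrow> f = (\<lambda>_. 0)"
  shows "inj_on L null_const"
proof (rule inj_onI)
  fix f g assume fg: "f \<in> null_const" "g \<in> null_const" and "L f = L g"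
  then have "L (\<lambda>x. 1 * f x + (-1) * g x) = (\<lambda>_. 0)"
    unfolding linear[OF fg] by simp
  from kernel[OF null_const_linear[OF fg] this] show "f = g"
    by (auto simp: fun_eq_iff)
qed

text \<open>This is where the limit at -\<infinity> fixes the integration constant.\<close>

lemma null_const_deriv_zero:
  assumes "f \<in> null_const" "\<And>x. (f has_real_derivative 0) (at x)"
  shows "f = (\<lambda>_. 0)"
proof -
  obtain c where c: "f = (\<lambda>_. c)"
    using DERIV_isconst_all[of f] assms(2) by blast
  then have "((\<lambda>_. c) \<longlongrightarrow> 0) (at_bot :: real filter)"
    using assms(1) by (simp add: null_const_def)
  then show ?thesis
    using c tendsto_const_iff[of "at_bot :: real filter" c 0] by simp
qed

text \<open>After multiplication by \<open>exp (- (m * x))\<close> the combination tends to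
  \<open>0\<close> at +\<infinity> by the bound, and to \<open>a\<close> by direct
  evaluation.\<close>

lemma bounded_exp_combination_coeff_zero:
  fixes a b m M :: real
  assumes "m > 0" "\<And>x. \<bar>a * exp (m * x) + b * exp (- (m * x))\<bar> \<le> M"
  shows "a = 0"
proof -
  have top: "filterlim (\<lambda>x. m * x) at_top at_top"
    using assms(1) by (simp add: filterlim_tendsto_pos_mult_at_top[OF tendsto_const] filterlim_ident)
  have e0: "((\<lambda>x. exp (- (m * x))) \<longlongrightarrow> 0) at_top"
    using filterlim_compose[OF exp_at_bot filterlim_compose[OF filterlim_uminus_at_bot_at_top top]]
    by simp
  have "((\<lambda>x. (a * exp (m * x) + b * exp (- (m * x))) * exp (- (m * x))) \<longlongrightarrow> 0) at_top"
  proof (rule Lim_null_comparison)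
    show "\<forall>\<^sub>F x in at_top. norm ((a * exp (m * x) + b * exp (- (m * x))) * exp (- (m * x)))
        \<le> M * exp (- (m * x))"
      using assms(2) by (intro always_eventually allI) (simp add: abs_mult)
    show "((\<lambda>x. M * exp (- (m * x))) \<longlongrightarrow> 0) at_top"
      using tendsto_mult[OF tendsto_const e0, of M] by simp
  qed
  moreover have "((\<lambda>x. (a * exp (m * x) + b * exp (- (m * x))) * exp (- (m * x))) \<longlongrightarrow> a + b * 0 * 0) at_top"
  proof -
    have "(\<lambda>x. (a * exp (m * x) + b * exp (- (m * x))) * exp (- (m * x)))
        = (\<lambda>x. a + b * exp (- (m * x)) * exp (- (m * x)))"
      by (simp add: fun_eq_iff algebra_simps flip: exp_add)
    then show ?thesis
      by (simp only:) (intro tendsto_intros e0)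
  qed
  ultimately show ?thesis
    using tendsto_unique[OF trivial_limit_at_top_linorder] by fastforce
qed

text \<open>The equation \<open>k'' = m^2 k\<close> factors into first-order ones:
  \<open>k' + m k\<close> is a multiple of \<open>exp (m x)\<close> and \<open>m k - k'\<close> of
  \<open>exp (- m x)\<close>. Their sum expresses \<open>2 m k\<close> by the two exponentials, and
  boundedness kills both coefficients.\<close>

lemma bounded_solution_zero:
  fixes k k1 :: "real \<Rightarrow> real"
  assumes "m > 0" and bdd: "bounded (range k)"
    and k: "\<And>x. (k has_real_derivative k1 x) (at x)"
    and k1: "\<And>x. (k1 has_real_derivative m\<^sup>2 * k x) (at x)"
  shows "k = (\<lambda>_. 0)"
proof -
  have "((\<lambda>x. (k1 x + m * k x) * exp (- (m * x))) has_real_derivative 0) (at x)" for x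
    by (auto intro!: derivative_eq_intros k k1 simp: algebra_simps power2_eq_square)
  then obtain a where "\<And>x. (k1 x + m * k x) * exp (- (m * x)) = a"
    using DERIV_isconst_all by meson
  then have a: "k1 x + m * k x = a * exp (m * x)" for x
    by (simp add: exp_minus divide_simps)
  have "((\<lambda>x. (m * k x - k1 x) * exp (m * x)) has_real_derivative 0) (at x)" for x
    by (auto intro!: derivative_eq_intros k k1 simp: algebra_simps power2_eq_square)
  then obtain b where "\<And>x. (m * k x - k1 x) * exp (m * x) = b"
    using DERIV_isconst_all by meson
  then have b: "m * k x - k1 x = b * exp (- (m * x))" for x
    by (simp add: exp_minus divide_simps)
  have k_eq: "2 * m * k x = a * exp (m * x) + b * exp (- (m * x))" for x
    using a[of x] b[of x] by linarith
  obtain B where "\<And>x. \<bar>k x\<bar> \<le> B"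
    using bdd by (auto simp: bounded_iff)
  then have le: "\<bar>a * exp (m * x) + b * exp (- (m * x))\<bar> \<le> 2 * m * B" for x
    using assms(1) by (simp add: abs_mult flip: k_eq)
  have "a = 0"
    using bounded_exp_combination_coeff_zero[OF assms(1) le] .
  \<comment> \<open>The reflection of \<open>x\<close> to \<open>- x\<close> exchanges the two
    exponentials, so the bound just used for \<open>a\<close> applies to \<open>b\<close>.\<close>
  moreover have "b = 0"
    using bounded_exp_combination_coeff_zero[of m b a "2 * m * B"] assms(1) le[of "- x" for x]
    by (simp add: add.commute)
  ultimately show ?thesis
    using k_eq assms(1) by (auto simp: fun_eq_iff)
qed

section \<open>Trivial kernels of the individual operators\<close>

lemma inj_on_deriv: "inj_on deriv null_const"
proof (rule inj_on_null_constI)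
  show "deriv (\<lambda>x. 1 * f x + (-1) * g x) = (\<lambda>x. 1 * deriv f x + (-1) * deriv g x)"
    if "f \<in> null_const" "g \<in> null_const" for f g :: "real \<Rightarrow> real"
    using that iterated_deriv_linear[of f g 1 1 "-1"] by (simp add: null_const_def)
  show "f = (\<lambda>_. 0)" if "f \<in> null_const" "deriv f = (\<lambda>_. 0)" for f :: "real \<Rightarrow> real"
    using that smooth_fun_DERIV[of f] by (auto simp: null_const_def intro!: null_const_deriv_zero)
qed

lemma inj_on_helmholtz: "inj_on helmholtz null_const"
proof (rule inj_on_null_constI)
  show "helmholtz (\<lambda>x. 1 * f x + (-1) * g x) = (\<lambda>x. 1 * helmholtz f x + (-1) * helmholtz g x)"
    if "f \<in> null_const" "g \<in> null_const" for f g
    using that iterated_deriv_linear[of f g 2 1 "-1"]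
    by (simp add: null_const_def helmholtz_def fun_eq_iff)
  show "f = (\<lambda>_. 0)" if f: "f \<in> null_const" and L: "helmholtz f = (\<lambda>_. 0)" for f
  proof (rule bounded_solution_zero)
    have smooth: "smooth_fun f"
      using f by (simp add: null_const_def)
    show "bounded (range f)" "0 < (1 :: real)"
      using f by (auto simp: null_const_def)
    show "(f has_real_derivative deriv f x) (at x)" for x
      by (rule smooth_fun_DERIV[OF smooth])
    have "(deriv ^^ 2) f x = f x" for x
      using fun_cong[OF L, of x] by (simp add: helmholtz_def)
    then show "(deriv f has_real_derivative 1\<^sup>2 * f x) (at x)" for x
      using smooth_fun_has_real_derivative[OF smooth, of 1 x] by (simp add: numeral_2_eq_2)
  qed
qed

text \<open>The operator is the derivative of \<open>f'' - 4 f\<close>, so on its kernel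
  \<open>f'' - 4 f\<close> is a constant \<open>c\<close>. The shift by \<open>c / 4\<close> absorbs
  it and leaves \<open>k'' = 4 k\<close>, the case \<open>m = 2\<close> of
  \<open>bounded_solution_zero\<close>. Hence \<open>f\<close> is constant, and the limit at
  -\<infinity> makes it zero.\<close>

lemma inj_on_cubic: "inj_on (\<lambda>g x. (deriv ^^ 3) g x - 4 * deriv g x) null_const"
proof (rule inj_on_null_constI)
  show "(\<lambda>x. (deriv ^^ 3) (\<lambda>x. 1 * f x + (-1) * g x) x - 4 * deriv (\<lambda>x. 1 * f x + (-1) * g x) x)
      = (\<lambda>x. 1 * ((deriv ^^ 3) f x - 4 * deriv f x) + (-1) * ((deriv ^^ 3) g x - 4 * deriv g x))"
    if "f \<in> null_const" "g \<in> null_const" for f g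
    using that iterated_deriv_linear[of f g 3 1 "-1"] iterated_deriv_linear[of f g 1 1 "-1"]
    by (simp add: null_const_def fun_eq_iff)
  show "f = (\<lambda>_. 0)"
    if f: "f \<in> null_const" and L: "(\<lambda>x. (deriv ^^ 3) f x - 4 * deriv f x) = (\<lambda>_. 0)" for f
  proof -
    have smooth: "smooth_fun f"
      using f by (simp add: null_const_def)
    have "((\<lambda>x. (deriv ^^ 2) f x - 4 * f x) has_real_derivative 0) (at x)" for x
      using DERIV_diff[OF smooth_fun_has_real_derivative[OF smooth, of 2 x]
          DERIV_cmult[OF smooth_fun_DERIV[OF smooth], where c = 4]] fun_cong[OF L, of x]
      by (simp add: numeral_3_eq_3 numeral_2_eq_2)
    then obtain c where c: "\<And>x. (deriv ^^ 2) f x - 4 * f x = c"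
      using DERIV_isconst_all by meson
    have "(\<lambda>x. f x + c / 4) = (\<lambda>_. 0)"
    proof (rule bounded_solution_zero)
      show "bounded (range (\<lambda>x. f x + c / 4))"
        using f by (intro bounded_plus_comp) (auto simp: null_const_def)
      show "((\<lambda>x. f x + c / 4) has_real_derivative deriv f x) (at x)" for x
        by (auto intro!: derivative_eq_intros smooth_fun_DERIV[OF smooth])
      show "(deriv f has_real_derivative 2\<^sup>2 * (f x + c / 4)) (at x)" for x
        using smooth_fun_has_real_derivative[OF smooth, of 1 x] c[of x]
        by (simp add: numeral_2_eq_2 algebra_simps)
    qed simp
    then have "f = (\<lambda>_. - (c / 4))"
      by (simp add: fun_eq_iff eq_neg_iff_add_eq_0)
    with f show ?thesis
      by (metis null_const_deriv_zero DERIV_const)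
  qed
qed

lemma inj_on_op_J: "inj_on op_J null_const3"
proof (rule inj_onI)
  fix Y Z assume Y: "Y \<in> null_const3" and Z: "Z \<in> null_const3" and eq: "op_J Y = op_J Z"
  have comp: "(\<lambda>x. Y x $ i) \<in> null_const" "(\<lambda>x. Z x $ i) \<in> null_const" for i
    using Y Z by (auto simp: null_const3_def)
  have eq': "op_J Y x $ i = op_J Z x $ i" for x i
    by (simp add: eq)
  have "deriv (\<lambda>x. Y x $ 1) = deriv (\<lambda>x. Z x $ 1)"
    using eq'[of _ 1] by (simp add: op_J_def Let_def fun_eq_iff)
  then have 1: "(\<lambda>x. Y x $ 1) = (\<lambda>x. Z x $ 1)"
    using inj_on_deriv comp by (auto dest: inj_onD)
  have "helmholtz (\<lambda>x. Y x $ 3) = helmholtz (\<lambda>x. Z x $ 3)"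
    using eq'[of _ 2] by (simp add: op_J_def Let_def fun_eq_iff)
  then have 3: "(\<lambda>x. Y x $ 3) = (\<lambda>x. Z x $ 3)"
    using inj_on_helmholtz comp by (auto dest: inj_onD)
  \<comment> \<open>The third row of \<open>op_J\<close> is minus \<open>helmholtz\<close> of the
    second component, so the sign is reversed on both sides.\<close>
  have "helmholtz (\<lambda>x. Y x $ 2) = helmholtz (\<lambda>x. Z x $ 2)"
    unfolding helmholtz_def
  proof
    show "Y x $ 2 - (deriv ^^ 2) (\<lambda>x. Y x $ 2) x = Z x $ 2 - (deriv ^^ 2) (\<lambda>x. Z x $ 2) x" for x
      using eq'[of x 3] by (simp add: op_J_def Let_def)
  qed
  then have 2: "(\<lambda>x. Y x $ 2) = (\<lambda>x. Z x $ 2)"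
    using inj_on_helmholtz comp by (auto dest: inj_onD)
  show "Y = Z"
    using 1 2 3 by (simp add: fun_eq_iff vec_eq_iff forall_3)
qed


subsection \<open>Homogeneity of the operators\<close>

text \<open>The chosen preimage and the default \<open>0\<close> both lie in \<open>G\<close>, so
  smoothness of the value is available without any knowledge about the image.\<close>

lemma formal_inv_in:
  assumes "(\<lambda>_. 0) \<in> G"
  shows "formal_inv G L f \<in> G"
  using assms by (simp add: formal_inv_def inv_into_into)

text \<open>On the image, injectivity makes the inverse a genuine one and scaling passes through.
  Off the image both sides are the default \<open>0\<close>, since a nonzero factor cannot move
  \<open>f\<close> into the image. Thus \<open>f\<close> may be arbitrary, and solvability never has
  to be checked along the recursion.\<close>

lemma formal_inv_scale:
  fixes L :: "(real \<Rightarrow> 'b::real_vector) \<Rightarrow> (real \<Rightarrow> 'b)"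
  assumes inj: "inj_on L G" and zero: "(\<lambda>_. 0) \<in> G"
    and G_scale: "\<And>c g. g \<in> G \<Longrightarrow> (\<lambda>x. c *\<^sub>R g x) \<in> G"
    and L_scale: "\<And>c g. g \<in> G \<Longrightarrow> L (\<lambda>x. c *\<^sub>R g x) = (\<lambda>x. c *\<^sub>R L g x)"
  shows "formal_inv G L (\<lambda>x. c *\<^sub>R f x) = (\<lambda>x. c *\<^sub>R formal_inv G L f x)"
proof -
  have eqI: "formal_inv G L (L g) = g" if "g \<in> G" for g
    using that inj by (simp add: formal_inv_def)
  show ?thesis
  proof (cases "f \<in> L ` G")
    case True
    then obtain g where g: "g \<in> G" "f = L g" by auto
    then show ?thesis
      using eqI[OF G_scale[OF g(1), of c]] eqI[OF g(1)] by (simp add: L_scale)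
  next
    case f: False
    show ?thesis
    proof (cases "c = 0")
      case True
      \<comment> \<open>The factor \<open>0\<close> moves \<open>f\<close> into the image:
        \<open>L\<close> maps the zero function to itself, and by injectivity its preimage is zero,
        which agrees with the right-hand side.\<close>
      then show ?thesis
        using eqI[OF zero] L_scale[OF zero, of 0] by simp
    next
      case False
      have "(\<lambda>x. c *\<^sub>R f x) \<notin> L ` G"
      proof
        assume "(\<lambda>x. c *\<^sub>R f x) \<in> L ` G"
        then obtain g where g: "g \<in> G" "(\<lambda>x. c *\<^sub>R f x) = L g" by auto
        have "L (\<lambda>x. inverse c *\<^sub>R g x) = f"
          using False by (simp add: L_scale[OF g(1)] flip: g(2))
        then show False
          using f G_scale[OF g(1), of "inverse c"] by blast
      qed
      then show ?thesis
        using f by (simp add: formal_inv_def)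
    qed
  qed
qed

section \<open>Scaling of the concrete inverses\<close>

lemma null_const_smooth: "f \<in> null_const \<Longrightarrow> smooth_fun f"
  by (simp add: null_const_def)

lemma helmholtz_scale:
  "smooth_fun f \<Longrightarrow> helmholtz (\<lambda>x. c * f x) = (\<lambda>x. c * helmholtz f x)"
  by (simp add: helmholtz_def iterated_deriv_scale right_diff_distrib)

lemma inv_deriv_scale: "inv_deriv (\<lambda>x. c * f x) = (\<lambda>x. c * inv_deriv f x)"
  using formal_inv_scale[OF inj_on_deriv null_const_zero, of c f]
    iterated_deriv_scale[where k = 1, OF null_const_smooth]
  by (simp add: inv_deriv_def null_const_scale)

lemma inv_helmholtz_scale: "inv_helmholtz (\<lambda>x. c * f x) = (\<lambda>x. c * inv_helmholtz f x)"
  using formal_inv_scale[OF inj_on_helmholtz null_const_zero, of c f]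
  by (simp add: inv_helmholtz_def null_const_scale helmholtz_scale null_const_smooth)

lemma inv_cubic_scale: "inv_cubic (\<lambda>x. c * f x) = (\<lambda>x. c * inv_cubic f x)"
  using formal_inv_scale[OF inj_on_cubic null_const_zero, of c f]
    iterated_deriv_scale[where k = 1, OF null_const_smooth]
  by (simp add: inv_cubic_def null_const_scale iterated_deriv_scale null_const_smooth algebra_simps)

lemma op_J_scale:
  assumes "Y \<in> null_const3"
  shows "op_J (\<lambda>x. c *\<^sub>R Y x) = (\<lambda>x. c *\<^sub>R op_J Y x)"
proof -
  have "smooth_fun (\<lambda>x. Y x $ i)" for i
    using assms by (simp add: null_const3_def null_const_smooth)
  then show ?thesis
    using iterated_deriv_scale[where k = 1]
    by (simp add: op_J_def Let_def fun_eq_iff vec_eq_iff forall_3 helmholtz_scale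
        iterated_deriv_scale algebra_simps)
qed

lemma inv_J_scale: "inv_J (\<lambda>x. c *\<^sub>R Y x) = (\<lambda>x. c *\<^sub>R inv_J Y x)"
  unfolding inv_J_def
  by (rule formal_inv_scale[OF inj_on_op_J null_const3_zero null_const3_scale op_J_scale])

section \<open>Scaling of the operators that depend on the field\<close>

text \<open>The factors \<open>c\<close> and \<open>d\<close> are kept apart because the field and
  the argument have different degrees in the recursion.\<close>

lemma op_Omega_scale:
  assumes \<theta>: "\<And>i. smooth_fun (\<lambda>x. \<theta> x $ i)" and f: "smooth_fun f"
  shows "op_Omega (\<lambda>x. c *\<^sub>R \<theta> x) (\<lambda>x. d * f x) = (\<lambda>x. (c * d) *\<^sub>R op_Omega \<theta> f x)"
proof -
  have "deriv (\<lambda>y. c * \<theta> y $ i * (d * f y)) x = c * d * deriv (\<lambda>y. \<theta> y $ i * f y) x" for i x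
    using deriv_scale[of "\<lambda>y. \<theta> y $ i * f y" x "c * d"] \<theta> f
    by (simp add: smooth_fun_differentiable mult_ac)
  then show ?thesis
    by (simp add: op_Omega_def Let_def fun_eq_iff vec_eq_iff forall_3
        deriv_scale smooth_fun_differentiable f algebra_simps)
qed

lemma op_Omega_adj_scale:
  assumes \<theta>: "\<And>i. smooth_fun (\<lambda>x. \<theta> x $ i)" and Y: "\<And>i. smooth_fun (\<lambda>x. Y x $ i)"
  shows "op_Omega_adj (\<lambda>x. c *\<^sub>R \<theta> x) (\<lambda>x. d *\<^sub>R Y x) = (\<lambda>x. (c * d) * op_Omega_adj \<theta> Y x)"
proof -
  have "deriv (\<lambda>y. c * \<theta> y $ i * (d * Y y $ i)) x = c * d * deriv (\<lambda>y. \<theta> y $ i * Y y $ i) x" for i x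
    using deriv_scale[of "\<lambda>y. \<theta> y $ i * Y y $ i" x "c * d"] \<theta> Y
    by (simp add: smooth_fun_differentiable mult_ac)
  then show ?thesis
    by (simp add: op_Omega_adj_def Let_def fun_eq_iff
        deriv_scale smooth_fun_differentiable Y algebra_simps)
qed

text \<open>Each term carries two factors from \<theta>: \<open>u^2\<close>, the pair around
  \<open>inv_deriv\<close>, or one each from \<open>op_Omega\<close> and
  \<open>op_Omega_adj\<close>. This gives \<open>c^2\<close>; the dependence on \<open>Y\<close> is
  of first degree.\<close>

lemma op_K_scale:
  assumes \<theta>: "\<And>i. smooth_fun (\<lambda>x. \<theta> x $ i)" and Y: "\<And>i. smooth_fun (\<lambda>x. Y x $ i)"
  shows "op_K (\<lambda>x. c *\<^sub>R \<theta> x) (\<lambda>x. d *\<^sub>R Y x) = (\<lambda>x. (c\<^sup>2 * d) *\<^sub>R op_K \<theta> Y x)"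
proof -
  have inv: "inv_deriv (\<lambda>y. c * \<theta> y $ i * (d * Y y $ i)) x
      = c * d * inv_deriv (\<lambda>y. \<theta> y $ i * Y y $ i) x" for i x
    using inv_deriv_scale[of "c * d" "\<lambda>y. \<theta> y $ i * Y y $ i"] by (simp add: mult_ac)
  \<comment> \<open>\<open>op_Omega\<close> differentiates this function, so its scaling law
    requires smoothness.\<close>
  have "smooth_fun (inv_cubic g)" for g
    unfolding inv_cubic_def by (intro null_const_smooth formal_inv_in null_const_zero)
  then have Omega: "op_Omega (\<lambda>x. c *\<^sub>R \<theta> x)
        (inv_cubic (op_Omega_adj (\<lambda>x. c *\<^sub>R \<theta> x) (\<lambda>x. d *\<^sub>R Y x)))
      = (\<lambda>x. (c * (c * d)) *\<^sub>R op_Omega \<theta> (inv_cubic (op_Omega_adj \<theta> Y)) x)"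
    by (simp add: op_Omega_adj_scale[OF \<theta> Y] inv_cubic_scale op_Omega_scale[OF \<theta>])
  show ?thesis
    unfolding op_K_def Let_def Omega
    by (simp add: inv fun_eq_iff vec_eq_iff forall_3)
       (simp add: algebra_simps power2_eq_square)
qed


subsection \<open>The hierarchy and its Hamiltonians\<close>

lemma hierarchy_one: "hierarchy 1 \<theta> = (\<lambda>x. vector [0, r_of \<theta> x, p_of \<theta> x])"
  by (simp add: hierarchy_def)

lemma hierarchy_Suc:
  assumes "n \<ge> 1"
  shows "hierarchy (Suc n) \<theta> = inv_J (op_K \<theta> (hierarchy n \<theta>))"
proof -
  obtain m where "n = Suc m"
    using assms by (cases n) auto
  then show ?thesis
    by (simp add: hierarchy_def)
qed

text \<open>The nonzero components at \<open>n = 1\<close> and all later fields are values of formal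
  inverses. The smoothness obtained here is what \<open>op_K_scale\<close> needs.\<close>

lemma hierarchy_in_null_const3:
  assumes "n \<ge> 1"
  shows "hierarchy n \<theta> \<in> null_const3"
  using assms
proof (induction n rule: dec_induct)
  case base
  have "inv_helmholtz f \<in> null_const" for f
    unfolding inv_helmholtz_def by (intro formal_inv_in null_const_zero)
  then show ?case
    unfolding hierarchy_one
    by (simp add: null_const3_def forall_3 p_of_def r_of_def null_const_zero)
next
  case (step n)
  then show ?case
    by (simp add: hierarchy_Suc inv_J_def formal_inv_in null_const3_zero)
qed

lemma hierarchy_homogeneous:
  assumes "n \<ge> 1" "\<theta> \<in> schwartz3"
  shows "hierarchy n (\<lambda>x. c *\<^sub>R \<theta> x) = (\<lambda>x. c ^ (2 * n - 1) *\<^sub>R hierarchy n \<theta> x)"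
  using assms(1)
proof (induction n rule: dec_induct)
  case base
  show ?case
    unfolding hierarchy_one
    by (simp add: p_of_def r_of_def inv_helmholtz_scale fun_eq_iff vec_eq_iff forall_3)
next
  case (step n)
  have \<theta>: "smooth_fun (\<lambda>x. \<theta> x $ i)" for i
    using assms(2) by (simp add: schwartz3_def schwartz_def)
  have Y: "smooth_fun (\<lambda>x. hierarchy n \<theta> x $ i)" for i
    using hierarchy_in_null_const3[OF step(1)] by (simp add: null_const3_def null_const_smooth)
  \<comment> \<open>The subtraction is truncated, so this relies on \<open>n\<close> being at least
    \<open>1\<close>.\<close>
  have "2 * Suc n - 1 = 2 + (2 * n - 1)"
    using step(1) by simp
  then have "c ^ (2 * Suc n - 1) = c\<^sup>2 * c ^ (2 * n - 1)"
    by (simp only: power_add)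
  then show ?case
    using step by (simp add: hierarchy_Suc op_K_scale[OF \<theta> Y] inv_J_scale del: mult_Suc_right)
qed

text \<open>The definition only gives derivatives at parameter \<open>0\<close>. Taking
  \<open>t\<close>\<theta> as base point and \<theta> as direction stays on the ray, and a shift of
  the parameter moves the derivative to \<open>t\<close>.\<close>

lemma has_variational_derivative_along_ray:
  assumes "has_variational_derivative F X" "\<theta> \<in> schwartz3"
  shows "((\<lambda>t. F (\<lambda>x. t *\<^sub>R \<theta> x)) has_real_derivative
           (LINT x|lborel. X (\<lambda>x. t *\<^sub>R \<theta> x) x \<bullet> \<theta> x)) (at t)"
proof -
  have "((\<lambda>s. F (\<lambda>x. t *\<^sub>R \<theta> x + s *\<^sub>R \<theta> x)) has_real_derivative
           (LINT x|lborel. X (\<lambda>x. t *\<^sub>R \<theta> x) x \<bullet> \<theta> x)) (at 0)"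
    using assms schwartz3_scale by (simp add: has_variational_derivative_def)
  then show ?thesis
    using DERIV_shift[of "\<lambda>t. F (\<lambda>x. t *\<^sub>R \<theta> x)" _ 0 t]
    by (simp add: scaleR_add_left add.commute)
qed

text \<open>Euler's identity for homogeneous functionals: along the ray the derivative is
  \<open>t ^ (m - 1)\<close> times a constant, so subtracting its antiderivative leaves a constant
  function of \<open>t\<close>.\<close>

lemma homogeneous_variational_derivative_Euler:
  assumes var: "has_variational_derivative F X" and \<theta>: "\<theta> \<in> schwartz3" and "m \<ge> 1"
    and hom: "\<And>c. X (\<lambda>x. c *\<^sub>R \<theta> x) = (\<lambda>x. c ^ (m - 1) *\<^sub>R X \<theta> x)"
    and zero: "F (\<lambda>_. 0) = 0"
  shows "F \<theta> = 1 / real m * (LINT x|lborel. X \<theta> x \<bullet> \<theta> x)"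
proof -
  let ?I = "LINT x|lborel. X \<theta> x \<bullet> \<theta> x"
  let ?g = "\<lambda>t. F (\<lambda>x. t *\<^sub>R \<theta> x) - t ^ m / real m * ?I"
  have "((\<lambda>t. F (\<lambda>x. t *\<^sub>R \<theta> x)) has_real_derivative t ^ (m - 1) * ?I) (at t)" for t
    using has_variational_derivative_along_ray[OF var \<theta>, of t] by (simp add: hom)
  then have "(?g has_real_derivative 0) (at t)" for t
    using \<open>m \<ge> 1\<close> by (auto intro!: derivative_eq_intros)
  \<comment> \<open>At \<open>t = 0\<close> the ray passes through the zero field, where
    \<open>F\<close> vanishes, and \<open>t ^ m\<close> vanishes as well.\<close>
  then have "?g 1 = ?g 0"
    using DERIV_isconst_all by blast
  then show ?thesis
    using \<open>m \<ge> 1\<close> zero by (simp add: power_0_left)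
qed

theorem proposition1:
  fixes H :: "nat \<Rightarrow> (real \<Rightarrow> real^3) \<Rightarrow> real"
  assumes H_1: "\<And>\<theta>. \<theta> \<in> schwartz3 \<Longrightarrow> H 1 \<theta> = (LINT x|lborel. p_of \<theta> x * \<theta> x $ 3)"
    and H_variational: "\<And>n. n \<ge> 1 \<Longrightarrow> has_variational_derivative (H n) (hierarchy n)"
    and H_zero: "\<And>n. n \<ge> 1 \<Longrightarrow> H n (\<lambda>_. 0) = 0"
  shows "(\<forall>n\<ge>1. \<forall>\<theta>\<in>schwartz3. \<forall>\<epsilon>::real.
            hierarchy n (\<lambda>x. \<epsilon> *\<^sub>R \<theta> x) = (\<lambda>x. \<epsilon> ^ (2 * n - 1) *\<^sub>R hierarchy n \<theta> x)) \<and>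
         (\<forall>n\<ge>1. \<forall>\<theta>\<in>schwartz3.
            H n \<theta> = 1 / (2 * real n) * (LINT x|lborel. hierarchy n \<theta> x \<bullet> \<theta> x))"
proof (intro conjI allI impI ballI)
  fix n :: nat and \<theta> assume n: "n \<ge> 1" and \<theta>: "\<theta> \<in> schwartz3"
  show "hierarchy n (\<lambda>x. \<epsilon> *\<^sub>R \<theta> x) = (\<lambda>x. \<epsilon> ^ (2 * n - 1) *\<^sub>R hierarchy n \<theta> x)" for \<epsilon>
    by (rule hierarchy_homogeneous[OF n \<theta>])
  \<comment> \<open>The functional has degree \<open>m = 2 * n\<close>, one more than its
    gradient.\<close>
  then show "H n \<theta> = 1 / (2 * real n) * (LINT x|lborel. hierarchy n \<theta> x \<bullet> \<theta> x)"
    using homogeneous_variational_derivative_Euler[OF H_variational[OF n] \<theta>, of "2 * n"] n H_zero[OF n]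
    by simp
qed

end
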